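(* Let $D$ be a connected finite type Dynkin diagram. There is a natural stratification $$\widetilde{\mathcal{M}}_D=\bigsqcup_F\mathcal{M}_D(F),$$ where $F$ varies over all the faces of the generalized associahedron, i.e. over all (possibly empty) pairwise compatible subsets $F=\{\gamma_1,\dots,\gamma_d\}$ of $\Pi$; here $\mathcal{M}_D(F)$ is the locally closed subscheme of $\widetilde{\mathcal{M}}_D$ on which $u_\gamma=0$ for $\gamma\in F$ and $u_\gamma\ne0$ for $\gamma\notin F$.
   Context: Cluster set-up. $D$ is a connected finite type Dynkin diagram with vertex set $I$, $n=|I|$, and Cartan matrix $(a_{ij})$. Fix an orientation of the underlying tree of $D$, with edges written $i\to j$; the associated exchange matrix $B$ (of type $D$) has $B_{ij}=-a_{ij}$ if $i\to j$, $B_{ij}=a_{ij}$ if $j\to i$, and $B_{ij}=0$ otherwise. An extended exchange matrix $\tilde B$ is an $(n+m)\times n$ integer matrix with top $n\times n$ block $B$. The cluster algebra $\mathcal{A}(\tilde B)$ is the $\mathbb{C}$-algebra generated by all mutable cluster variables, the frozen variables and the inverses of the frozen variables; the exchange relation at a seed with matrix $(b_{ij})$ is $x_kx_k'=\prod_{b_{ik}>0}x_i^{b_{ik}}+\prod_{b_{ik}<0}x_i^{-b_{ik}}$. Indexing. Put $x_{(0,i)}=x_i$ (initial cluster) and, for $t\ge1$, let the cluster $\{x_{(t,i)}\mid i\in I\}$ be obtained from $\{x_{(t-1,i)}\mid i\in I\}$ by mutating exactly once at each $i\in I$, always at a source of the current orientation ($i\to j$ iff $b_{ij}>0$). Let $r_i+1$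 be the least positive $t$ such that $x_{(t,i)}$ is an initial variable and write $x_{(r_i+1,i)}=x_{(0,i^* )}$; $i\mapsto i^*$ is an involution of $I$. Set $\Pi=\{(s,i)\mid i\in I,\ 0\le s\le r_i\}$; then $\gamma\mapsto x_\gamma$ is a bijection from $\Pi$ to the set of mutable cluster variables. Put $(-1,i):=(r_{i^*},i^* )$ and let $\tau:\Pi\to\Pi$ be the bijection $\tau(t,j)=(t-1,j)$. Compatibility degree. $(\omega\|\gamma)\in\mathbb{Z}_{\ge0}$, for $\omega,\gamma\in\Pi$, is the unique function with $(\tau\omega\|\tau\gamma)=(\omega\|\gamma)$ and such that $((0,i)\|\gamma)$ is $\max(0,d_i)$, where $d_i$ is the exponent of $x_i$ in the denominator of the Laurent expansion of $x_\gamma$ in the initial cluster (so $(\gamma\|\gamma)=0$). Elements $\omega,\gamma$ are compatible if $(\omega\|\gamma)=0$ (equivalently $(\gamma\|\omega)=0$). Cluster configuration space. $\mathbb{C}[u]=\mathbb{C}[u_\gamma\mid\gamma\in\Pi]$, and $I_D$ is the ideal generated by the elements $R_\gamma=u_\gamma+\prod_{\omega\in\Pi}u_\omega^{(\omega\|\gamma)}-1$, $\gamma\in\Pi$. $\widetilde{\mathcal{M}}_D=\operatorname{Spec}(\mathbb{C}[u]/I_D)$ and $\mathcal{M}_D$ is its open subscheme where all $u_\gamma$ are invertible. Strata. Faces of the generalized associahedron are identified with pairwise compatible subsets $F$ of $\Pi$. $\widetilde{\mathcal{M}}_D(F)$ is the closed subscheme of $\widetilde{\mathcal{M}}_D$ cut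 out by the ideal $(u_\gamma\mid\gamma\in F)$ (so $\widetilde{\mathcal{M}}_D(\varnothing)=\widetilde{\mathcal{M}}_D$), and $\mathcal{M}_D(F)$ is the open subscheme of $\widetilde{\mathcal{M}}_D(F)$ where all $u_\gamma$, $\gamma\notin F$, are non-vanishing. *)

theory Defs
  imports
    "HOL-Analysis.Analysis"
    "HOL-Algebra.QuotRing"
    "HOL-Library.Poly_Mapping"
    "HOL-Library.Disjoint_Sets"
    "HOL-Computational_Algebra.Polynomial_Factorial"
begin

section \<open>Complex polynomials and the spectrum of a ring\<close>

type_synonym 'v cpoly = "('v \<Rightarrow>\<^sub>0 nat) \<Rightarrow>\<^sub>0 complex"

definition pvar :: "'v \<Rightarrow> 'v cpoly" where
  "pvar v = Poly_Mapping.single (Poly_Mapping.single v 1) 1"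

text \<open>The ring of complex polynomials in the variables from \<open>V\<close> only, as a subring of all
  polynomials on the type of variables.\<close>

definition cpoly_ring :: "'v set \<Rightarrow> 'v cpoly ring" where
  "cpoly_ring V =
    \<lparr>carrier = {p. \<forall>m \<in> Poly_Mapping.keys p. Poly_Mapping.keys m \<subseteq> V},
     mult = (*), one = 1, zero = 0, add = (+)\<rparr>"

lemma cring_cpoly_ring: "cring (cpoly_ring V)"
proof (rule cringI)
  show "abelian_group (cpoly_ring V)"
  proof (rule abelian_groupI)
    fix p q assume "p \<in> carrier (cpoly_ring V)" "q \<in> carrier (cpoly_ring V)"
    then show "p \<oplus>\<^bsub>cpoly_ring V\<^esub> q \<in> carrier (cpoly_ring V)"
      using Poly_Mapping.keys_add[of p q] by (auto simp: cpoly_ring_def)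
  next
    fix p assume "p \<in> carrier (cpoly_ring V)"
    then have "- p \<in> carrier (cpoly_ring V)"
      by (auto simp: cpoly_ring_def in_keys_iff)
    then show "\<exists>q \<in> carrier (cpoly_ring V). q \<oplus>\<^bsub>cpoly_ring V\<^esub> p = \<zero>\<^bsub>cpoly_ring V\<^esub>"
      by (intro bexI[of _ "- p"]) (simp_all add: cpoly_ring_def)
  qed (auto simp: cpoly_ring_def add.assoc add.commute)
  show "comm_monoid (cpoly_ring V)"
  proof (rule comm_monoidI)
    fix p q assume pq: "p \<in> carrier (cpoly_ring V)" "q \<in> carrier (cpoly_ring V)"
    have "Poly_Mapping.keys m \<subseteq> V" if "m \<in> Poly_Mapping.keys (p * q)" for m
    proof -
      obtain a b where "m = a + b" "a \<in> Poly_Mapping.keys p" "b \<in> Poly_Mapping.keys q"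
        using \<open>m \<in> Poly_Mapping.keys (p * q)\<close> Poly_Mapping.keys_mult[of p q] by blast
      then show ?thesis
        using pq Poly_Mapping.keys_add[of a b] unfolding cpoly_ring_def by fastforce
    qed
    then show "p \<otimes>\<^bsub>cpoly_ring V\<^esub> q \<in> carrier (cpoly_ring V)"
      by (simp add: cpoly_ring_def)
  qed (auto simp: cpoly_ring_def mult.assoc mult.commute)
qed (simp add: cpoly_ring_def distrib_right)

definition Spec :: "('a, 'b) ring_scheme \<Rightarrow> 'a set set" where
  "Spec R = {P. primeideal P R}"

definition zero_locus :: "('a, 'b) ring_scheme \<Rightarrow> 'a set \<Rightarrow> 'a set set" where
  "zero_locus R A = {P \<in> Spec R. A \<subseteq> P}"

definition nonvanishing_locus :: "('a, 'b) ring_scheme \<Rightarrow> 'a \<Rightarrow> 'a set set" where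
  "nonvanishing_locus R f = {P \<in> Spec R. f \<notin> P}"

definition zariski :: "('a, 'b) ring_scheme \<Rightarrow> 'a set topology" where
  "zariski R = topology_generated_by (nonvanishing_locus R ` carrier R)"

lemma topspace_zariski: "topspace (zariski R) = Spec R"
proof -
  have "P \<in> nonvanishing_locus R \<one>\<^bsub>R\<^esub> \<and> \<one>\<^bsub>R\<^esub> \<in> carrier R" if "P \<in> Spec R" for P
  proof -
    interpret primeideal P R using that by (simp add: Spec_def)
    show ?thesis
      using that I_notcarr one_imp_carrier by (auto simp: nonvanishing_locus_def)
  qed
  then show ?thesis
    unfolding zariski_def topology_generated_by_topspace
    by (auto simp: nonvanishing_locus_def)
qed


section \<open>Dynkin diagrams and their exchange matrices\<close>

text \<open>A Dynkin diagram is given by its Cartan matrix; finite type means that some positive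
  diagonal rescaling of the Cartan matrix is symmetric and positive definite.\<close>

definition finite_type_cartan :: "'v set \<Rightarrow> ('v \<Rightarrow> 'v \<Rightarrow> int) \<Rightarrow> bool" where
  "finite_type_cartan I a \<longleftrightarrow>
     finite I \<and>
     (\<forall>i\<in>I. a i i = 2) \<and>
     (\<forall>i\<in>I. \<forall>j\<in>I. i \<noteq> j \<longrightarrow> a i j \<le> 0) \<and>
     (\<exists>d :: 'v \<Rightarrow> real.
        (\<forall>i\<in>I. d i > 0) \<and>
        (\<forall>i\<in>I. \<forall>j\<in>I. d i * a i j = d j * a j i) \<and>
        (\<forall>v :: 'v \<Rightarrow> real. (\<exists>i\<in>I. v i \<noteq> 0) \<longrightarrow>
            (\<Sum>i\<in>I. \<Sum>j\<in>I. d i * a i j * v i * v j) > 0))"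

definition connected_diagram :: "'v set \<Rightarrow> ('v \<Rightarrow> 'v \<Rightarrow> int) \<Rightarrow> bool" where
  "connected_diagram I a \<longleftrightarrow>
     I \<noteq> {} \<and> (\<forall>i\<in>I. \<forall>j\<in>I. (\<lambda>k l. k \<in> I \<and> l \<in> I \<and> a k l \<noteq> 0)\<^sup>*\<^sup>* i j)"

definition diagram_orientation ::
    "'v set \<Rightarrow> ('v \<Rightarrow> 'v \<Rightarrow> int) \<Rightarrow> ('v \<Rightarrow> 'v \<Rightarrow> bool) \<Rightarrow> bool" where
  "diagram_orientation I a arr \<longleftrightarrow>
     (\<forall>i j. arr i j \<longrightarrow> i \<in> I \<and> j \<in> I \<and> i \<noteq> j \<and> a i j \<noteq> 0) \<and>
     (\<forall>i\<in>I. \<forall>j\<in>I. i \<noteq> j \<and> a i j \<noteq> 0 \<longrightarrow> (arr i j \<longleftrightarrow> \<not> arr j i))"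

text \<open>The rows of an extended exchange matrix are indexed by the mutable indices \<open>I\<close> and the
  frozen indices \<open>J\<close>, its columns by \<open>I\<close>. The frozen rows are arbitrary.\<close>

definition extended_exchange_matrix ::
    "'v set \<Rightarrow> 'v set \<Rightarrow> ('v \<Rightarrow> 'v \<Rightarrow> int) \<Rightarrow> ('v \<Rightarrow> 'v \<Rightarrow> bool) \<Rightarrow> ('v \<Rightarrow> 'v \<Rightarrow> int) \<Rightarrow> bool" where
  "extended_exchange_matrix I J a arr B \<longleftrightarrow>
     finite J \<and> I \<inter> J = {} \<and>
     (\<forall>i\<in>I. \<forall>j\<in>I. B i j = (if arr i j then - a i j else if arr j i then a i j else 0))"


section \<open>Seeds and mutation\<close>

record 'v seed =
  cvar :: "'v \<Rightarrow> 'v cpoly fract"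
  emat :: "'v \<Rightarrow> 'v \<Rightarrow> int"

definition mutate ::
    "'v set \<Rightarrow> 'v set \<Rightarrow> 'v \<Rightarrow> ('v::linorder) seed \<Rightarrow> 'v seed" where
  "mutate I J k S =
    (let x = cvar S; b = emat S in
     \<lparr>cvar = x(k := ((\<Prod>i | i \<in> I \<union> J \<and> b i k > 0. x i ^ nat (b i k)) +
                     (\<Prod>i | i \<in> I \<union> J \<and> b i k < 0. x i ^ nat (- b i k))) / x k),
      emat = (\<lambda>i j. if i = k \<or> j = k then - b i j
                    else b i j + sgn (b i k) * max 0 (b i k * b k j))\<rparr>)"

definition is_source :: "'v set \<Rightarrow> ('v::linorder) seed \<Rightarrow> 'v \<Rightarrow> bool" where
  "is_source I S k \<longleftrightarrow> k \<in> I \<and> (\<forall>j\<in>I. \<not> emat S j k > 0)"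

fun source_mutations :: "'v set \<Rightarrow> 'v set \<Rightarrow> ('v::linorder) seed \<Rightarrow> 'v list \<Rightarrow> bool" where
  "source_mutations I J S [] = True"
| "source_mutations I J S (k # ks) =
     (is_source I S k \<and> source_mutations I J (mutate I J k S) ks)"

text \<open>\<open>S'\<close> arises from \<open>S\<close> by mutating exactly once at each mutable index, each time at a source.\<close>

definition source_sweep :: "'v set \<Rightarrow> 'v set \<Rightarrow> ('v::linorder) seed \<Rightarrow> 'v seed \<Rightarrow> bool" where
  "source_sweep I J S S' \<longleftrightarrow>
     (\<exists>ks. distinct ks \<and> set ks = I \<and> source_mutations I J S ks \<and> S' = fold (mutate I J) ks S)"

definition initial_seed :: "('v \<Rightarrow> 'v \<Rightarrow> int) \<Rightarrow> ('v::linorder) seed" where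
  "initial_seed B = \<lparr>cvar = (\<lambda>v. to_fract (pvar v)), emat = B\<rparr>"

text \<open>\<open>z = p / (\<Prod>v\<in>V. x\<^sub>v ^ e v)\<close> with \<open>p\<close> a polynomial that is divisible by none of the \<open>x\<^sub>v\<close>;
  the exponents \<open>e v\<close> may be negative.\<close>

definition laurent_denominator ::
    "'v set \<Rightarrow> ('v::linorder) cpoly fract \<Rightarrow> ('v \<Rightarrow> int) \<Rightarrow> bool" where
  "laurent_denominator V z e \<longleftrightarrow>
     (\<exists>p. (\<forall>v\<in>V. \<not> pvar v dvd p) \<and>
          z * (\<Prod>v\<in>V. to_fract (pvar v) powi e v) = to_fract p)"

definition denominator_exponent ::
    "'v set \<Rightarrow> ('v::linorder) cpoly fract \<Rightarrow> 'v \<Rightarrow> int" where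
  "denominator_exponent V z i = (THE d. \<exists>e. laurent_denominator V z e \<and> e i = d)"


section \<open>Cluster configuration spaces\<close>

text \<open>The order on \<open>'v\<close> serves only to make \<open>'v cpoly\<close> an integral domain in the library, so that
  \<open>'v cpoly fract\<close> is a field. The clusters of the seeds \<open>S t\<close> consist of the \<open>x\<^sub>(\<^sub>t\<^sub>,\<^sub>i\<^sub>)\<close>.\<close>

locale dynkin_cluster =
  fixes I J :: "('v::linorder) set"
    and a :: "'v \<Rightarrow> 'v \<Rightarrow> int"
    and arr :: "'v \<Rightarrow> 'v \<Rightarrow> bool"
    and B :: "'v \<Rightarrow> 'v \<Rightarrow> int"
    and S :: "nat \<Rightarrow> 'v seed"
  assumes cartan: "finite_type_cartan I a"
    and connected: "connected_diagram I a"
    and orientation: "diagram_orientation I a arr"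
    and exchange: "extended_exchange_matrix I J a arr B"
    and initial: "S 0 = initial_seed B"
    and sweep: "source_sweep I J (S t) (S (Suc t))"
begin

definition x :: "nat \<times> 'v \<Rightarrow> 'v cpoly fract" where
  "x \<gamma> = cvar (S (fst \<gamma>)) (snd \<gamma>)"

definition r :: "'v \<Rightarrow> nat" where
  "r i = (LEAST t. t > 0 \<and> (\<exists>j\<in>I. x (t, i) = x (0, j))) - 1"

definition star :: "'v \<Rightarrow> 'v" where
  "star i = (THE j. j \<in> I \<and> x (r i + 1, i) = x (0, j))"

definition PiD :: "(nat \<times> 'v) set" where
  "PiD = {(s, i). i \<in> I \<and> s \<le> r i}"

definition tau :: "nat \<times> 'v \<Rightarrow> nat \<times> 'v" where
  "tau = (\<lambda>(t, j). if t = 0 then (r (star j), star j) else (t - 1, j))"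

text \<open>\<open>deg \<omega> \<gamma>\<close> is the compatibility degree \<open>(\<omega>\<parallel>\<gamma>)\<close>. Only its values on \<open>PiD\<close> matter; the value 0
  elsewhere makes the function unique on the whole type.\<close>

definition deg :: "nat \<times> 'v \<Rightarrow> nat \<times> 'v \<Rightarrow> nat" where
  "deg = (THE c.
     (\<forall>\<omega>\<in>PiD. \<forall>\<gamma>\<in>PiD. c (tau \<omega>) (tau \<gamma>) = c \<omega> \<gamma>) \<and>
     (\<forall>i\<in>I. \<forall>\<gamma>\<in>PiD. int (c (0, i) \<gamma>) = max 0 (denominator_exponent (I \<union> J) (x \<gamma>) i)) \<and>
     (\<forall>\<omega> \<gamma>. \<omega> \<notin> PiD \<or> \<gamma> \<notin> PiD \<longrightarrow> c \<omega> \<gamma> = 0))"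

definition compatible :: "nat \<times> 'v \<Rightarrow> nat \<times> 'v \<Rightarrow> bool" where
  "compatible \<omega> \<gamma> \<longleftrightarrow> deg \<omega> \<gamma> = 0"

definition faces :: "(nat \<times> 'v) set set" where
  "faces = {F. F \<subseteq> PiD \<and> pairwise compatible F}"

definition relation :: "nat \<times> 'v \<Rightarrow> (nat \<times> 'v) cpoly" where
  "relation \<gamma> = pvar \<gamma> + (\<Prod>\<omega>\<in>PiD. pvar \<omega> ^ deg \<omega> \<gamma>) - 1"

definition relation_ideal :: "(nat \<times> 'v) cpoly set" where
  "relation_ideal = Idl\<^bsub>cpoly_ring PiD\<^esub> (relation ` PiD)"

definition coordinate_ring :: "(nat \<times> 'v) cpoly set ring" where
  "coordinate_ring = cpoly_ring PiD Quot relation_ideal"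

definition u :: "nat \<times> 'v \<Rightarrow> (nat \<times> 'v) cpoly set" where
  "u \<gamma> = relation_ideal +>\<^bsub>cpoly_ring PiD\<^esub> pvar \<gamma>"

text \<open>The underlying topological space of the affine scheme $\widetilde{\mathcal M}_D$.\<close>

definition M_tilde :: "(nat \<times> 'v) cpoly set set topology" where
  "M_tilde = zariski coordinate_ring"

text \<open>The underlying sets of $\widetilde{\mathcal M}_D(F)$ and $\mathcal M_D(F)$, inside the space above.
  The first is a closed subscheme, with ideal generated by the \<open>u \<gamma>\<close> for \<open>\<gamma> \<in> F\<close>; the second is open
  in it.\<close>

definition closed_stratum :: "(nat \<times> 'v) set \<Rightarrow> (nat \<times> 'v) cpoly set set set" where
  "closed_stratum F = zero_locus coordinate_ring (Idl\<^bsub>coordinate_ring\<^esub> (u ` F))"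

definition stratum :: "(nat \<times> 'v) set \<Rightarrow> (nat \<times> 'v) cpoly set set set" where
  "stratum F =
     {P \<in> closed_stratum F. \<forall>\<gamma> \<in> PiD - F. P \<in> nonvanishing_locus coordinate_ring (u \<gamma>)}"

end

text \<open>A stratification of a topological space: a partition into locally closed pieces, indexed by
  a family of sets, where the closure of a piece meets only pieces with larger index.\<close>

definition stratification :: "'p topology \<Rightarrow> 'f set set \<Rightarrow> ('f set \<Rightarrow> 'p set) \<Rightarrow> bool" where
  "stratification X \<F> Z \<longleftrightarrow>
     topspace X = (\<Union>F\<in>\<F>. Z F) \<and>
     disjoint_family_on Z \<F> \<and>
     (\<forall>F\<in>\<F>. \<exists>C U. closedin X C \<and> openin X U \<and> Z F = C \<inter> U) \<and>
     (\<forall>F\<in>\<F>. X closure_of Z F \<subseteq> (\<Union>G\<in>{G \<in> \<F>. F \<subseteq> G}. Z G))"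

end

theory Submission
  imports Defs
begin

text \<open>A point \<open>P\<close> of the spectrum lies in the stratum of \<open>F\<close>, for \<open>F \<subseteq> PiD\<close>, exactly when
  \<open>F\<close> is the set of all \<open>\<gamma>\<close> with \<open>u \<gamma> \<in> P\<close>. This set is a face: if \<open>P\<close> contained \<open>u \<gamma>\<close> and \<open>u \<omega>\<close>
  with \<open>deg \<omega> \<gamma> > 0\<close>, it would contain both summands of the left-hand side of
  \<open>u \<gamma> + (\<Prod>\<omega>. u \<omega> ^ deg \<omega> \<gamma>) = 1\<close>. A stratum is the intersection of its closed stratum with
  finitely many basic open sets, because \<open>PiD\<close> is finite, and the closed stratum of \<open>F\<close>
  contains only points whose face contains \<open>F\<close>.\<close>

text \<open>These closure facts use the operations of the polynomial type, in which
  \<open>relation\<close> is written, not those of the ring record.\<close>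

lemma one_in_cpoly_ring: "1 \<in> carrier (cpoly_ring V)"
  by (simp add: cpoly_ring_def)

lemma pvar_in_cpoly_ring: "v \<in> V \<Longrightarrow> pvar v \<in> carrier (cpoly_ring V)"
  by (simp add: cpoly_ring_def pvar_def)

lemma add_in_cpoly_ring:
  "p \<in> carrier (cpoly_ring V) \<Longrightarrow> q \<in> carrier (cpoly_ring V) \<Longrightarrow> p + q \<in> carrier (cpoly_ring V)"
  using Poly_Mapping.keys_add[of p q] by (auto simp: cpoly_ring_def)

lemma diff_in_cpoly_ring:
  assumes "p \<in> carrier (cpoly_ring V)" "q \<in> carrier (cpoly_ring V)"
  shows "p - q \<in> carrier (cpoly_ring V)"
  using assms Poly_Mapping.keys_diff[of p q] by (auto simp: cpoly_ring_def)

lemma mult_in_cpoly_ring: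
  assumes "p \<in> carrier (cpoly_ring V)" "q \<in> carrier (cpoly_ring V)"
  shows "p * q \<in> carrier (cpoly_ring V)"
  using monoid.m_closed[OF cring.axioms(1)[OF cring_cpoly_ring, THEN ring.axioms(2)] assms]
  by (simp add: cpoly_ring_def)

lemma power_in_cpoly_ring:
  "p \<in> carrier (cpoly_ring V) \<Longrightarrow> p ^ n \<in> carrier (cpoly_ring V)"
  by (induction n) (auto intro: one_in_cpoly_ring mult_in_cpoly_ring)

lemma prod_in_cpoly_ring:
  "(\<And>i. i \<in> A \<Longrightarrow> f i \<in> carrier (cpoly_ring V)) \<Longrightarrow> prod f A \<in> carrier (cpoly_ring V)"
  by (induction A rule: infinite_finite_induct)
    (auto intro: one_in_cpoly_ring mult_in_cpoly_ring)

lemma openin_nonvanishing_locus: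
  "f \<in> carrier R \<Longrightarrow> openin (zariski R) (nonvanishing_locus R f)"
  unfolding zariski_def by (auto intro: topology_generated_by_Basis)

text \<open>The complement is a union of the sets \<open>nonvanishing_locus R f\<close>, which are
  basic open sets because \<open>A\<close> lies in the carrier.\<close>

lemma closedin_zero_locus:
  assumes "A \<subseteq> carrier R"
  shows "closedin (zariski R) (zero_locus R A)"
proof -
  have "Spec R - zero_locus R A = (\<Union>f\<in>A. nonvanishing_locus R f)"
    by (auto simp: zero_locus_def nonvanishing_locus_def)
  moreover have "openin (zariski R) (\<Union>f\<in>A. nonvanishing_locus R f)"
    using assms by (auto intro: openin_nonvanishing_locus)
  ultimately show ?thesis
    by (auto simp: closedin_def topspace_zariski zero_locus_def)
qed

text \<open>A prime ideal is in particular an ideal, so it contains the ideal generated by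
  \<open>A\<close> as soon as it contains \<open>A\<close>.\<close>

lemma (in ring) zero_locus_genideal:
  assumes "A \<subseteq> carrier R"
  shows "zero_locus R (Idl\<^bsub>R\<^esub> A) = zero_locus R A"
proof -
  have "Idl\<^bsub>R\<^esub> A \<subseteq> P \<longleftrightarrow> A \<subseteq> P" if "P \<in> Spec R" for P
    using genideal_minimal[of P A] genideal_self[OF assms] primeideal.axioms(1)[of P R] that
    by (auto simp: Spec_def)
  then show ?thesis
    by (auto simp: zero_locus_def)
qed

context dynkin_cluster
begin

lemma finite_PiD: "finite PiD"
proof -
  have "finite I"
    using cartan by (simp add: finite_type_cartan_def)
  \<comment> \<open>Elements of \<open>PiD\<close> carry the level first, whereas the dependent sum
    must carry the index first; hence the swap.\<close>
  moreover have "PiD = prod.swap ` (SIGMA i:I. {..r i})"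
    by (auto simp: PiD_def image_iff)
  ultimately show ?thesis by simp
qed

lemma relation_in_carrier: "\<gamma> \<in> PiD \<Longrightarrow> relation \<gamma> \<in> carrier (cpoly_ring PiD)"
  unfolding relation_def
  by (intro diff_in_cpoly_ring add_in_cpoly_ring prod_in_cpoly_ring power_in_cpoly_ring
      pvar_in_cpoly_ring one_in_cpoly_ring)

lemma ideal_relation_ideal: "ideal relation_ideal (cpoly_ring PiD)"
  unfolding relation_ideal_def
  using relation_in_carrier
  by (intro ring.genideal_ideal[OF cring.axioms(1)[OF cring_cpoly_ring]]) auto

lemma cring_coordinate_ring: "cring coordinate_ring"
  unfolding coordinate_ring_def
  by (rule ideal.quotient_is_cring[OF ideal_relation_ideal cring_cpoly_ring])

text \<open>Polynomial identities are transported to the coordinate ring along this quotient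
  map.\<close>

lemma coset_ring_hom:
  "(+>\<^bsub>cpoly_ring PiD\<^esub>) relation_ideal \<in> ring_hom (cpoly_ring PiD) coordinate_ring"
  unfolding coordinate_ring_def by (rule ideal.rcos_ring_hom[OF ideal_relation_ideal])

lemma u_in_carrier: "\<gamma> \<in> PiD \<Longrightarrow> u \<gamma> \<in> carrier coordinate_ring"
  unfolding u_def by (rule ring_hom_closed[OF coset_ring_hom pvar_in_cpoly_ring])

lemma closed_stratum_eq:
  "F \<subseteq> PiD \<Longrightarrow> closed_stratum F = {P \<in> Spec coordinate_ring. \<forall>\<gamma>\<in>F. u \<gamma> \<in> P}"
  using u_in_carrier unfolding closed_stratum_def
  by (subst ring.zero_locus_genideal[OF cring.axioms(1)[OF cring_coordinate_ring]])
    (auto simp: zero_locus_def)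

text \<open>A point determines the subset of \<open>PiD\<close> whose stratum contains it, which
  gives disjointness and tells which stratum covers the point.\<close>

lemma stratum_eq:
  "F \<subseteq> PiD \<Longrightarrow> stratum F = {P \<in> Spec coordinate_ring. {\<gamma> \<in> PiD. u \<gamma> \<in> P} = F}"
  unfolding stratum_def by (auto simp: closed_stratum_eq nonvanishing_locus_def)

text \<open>The image of \<open>relation \<gamma>\<close> vanishes in the coordinate ring. Since the
  exponent of \<open>u \<omega>\<close> is positive, one factor \<open>u \<omega>\<close> can be
  split off the product; \<open>c\<close> is what remains.\<close>

lemma u_relation:
  assumes "\<gamma> \<in> PiD" "\<omega> \<in> PiD" "deg \<omega> \<gamma> > 0"
  obtains c where "c \<in> carrier coordinate_ring"
    "u \<gamma> \<oplus>\<^bsub>coordinate_ring\<^esub> u \<omega> \<otimes>\<^bsub>coordinate_ring\<^esub> c = \<one>\<^bsub>coordinate_ring\<^esub>"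
proof -
  let ?h = "(+>\<^bsub>cpoly_ring PiD\<^esub>) relation_ideal"
  interpret Q: cring coordinate_ring
    by (rule cring_coordinate_ring)
  interpret R: ideal relation_ideal "cpoly_ring PiD"
    by (rule ideal_relation_ideal)
  define q where "q = pvar \<omega> ^ (deg \<omega> \<gamma> - 1) * (\<Prod>\<psi>\<in>PiD - {\<omega>}. pvar \<psi> ^ deg \<psi> \<gamma>)"
  have q: "q \<in> carrier (cpoly_ring PiD)"
    using assms(2) unfolding q_def
    by (intro mult_in_cpoly_ring power_in_cpoly_ring prod_in_cpoly_ring pvar_in_cpoly_ring) auto
  note closed = q assms(1,2)[THEN pvar_in_cpoly_ring] relation_in_carrier[OF assms(1)]
    one_in_cpoly_ring
  have "(\<Prod>\<psi>\<in>PiD. pvar \<psi> ^ deg \<psi> \<gamma>) = pvar \<omega> * q"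
    using assms(2,3) finite_PiD
    by (simp add: q_def prod.remove[of _ \<omega>] power_eq_if mult.assoc)
  then have eq: "pvar \<gamma> + pvar \<omega> * q = 1 + relation \<gamma>"
    by (simp add: relation_def)
  have "relation \<gamma> \<in> relation_ideal"
    unfolding relation_ideal_def
    using ring.genideal_self[OF cring.axioms(1)[OF cring_cpoly_ring], of "relation ` PiD"]
      relation_in_carrier assms(1) by blast
  \<comment> \<open>The coset of an element of the ideal is the ideal itself, the zero of the
    quotient.\<close>
  then have rel: "?h (relation \<gamma>) = \<zero>\<^bsub>coordinate_ring\<^esub>"
    by (simp add: R.a_rcos_const coordinate_ring_def FactRing_def)
  have "u \<gamma> \<oplus>\<^bsub>coordinate_ring\<^esub> u \<omega> \<otimes>\<^bsub>coordinate_ring\<^esub> ?h q = ?h (pvar \<gamma> + pvar \<omega> * q)"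
    using ring_hom_add[OF coset_ring_hom closed(2) mult_in_cpoly_ring[OF closed(3,1)]]
      ring_hom_mult[OF coset_ring_hom closed(3,1)]
    by (simp add: u_def) (simp add: cpoly_ring_def)
  also have "\<dots> = ?h 1 \<oplus>\<^bsub>coordinate_ring\<^esub> ?h (relation \<gamma>)"
    using ring_hom_add[OF coset_ring_hom closed(5,4)] unfolding eq
    by (simp add: cpoly_ring_def)
  also have "\<dots> = \<one>\<^bsub>coordinate_ring\<^esub>"
    using ring_hom_one[OF coset_ring_hom] by (simp add: rel) (simp add: cpoly_ring_def)
  finally show thesis
    using that ring_hom_closed[OF coset_ring_hom q] by blast
qed

text \<open>The claim inside is for ordered pairs, so it covers both orders that
  \<open>pairwise\<close> asks for.\<close>

lemma vanishing_set_in_faces: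
  assumes "P \<in> Spec coordinate_ring"
  shows "{\<gamma> \<in> PiD. u \<gamma> \<in> P} \<in> faces"
proof -
  interpret P: primeideal P coordinate_ring
    using assms by (simp add: Spec_def)
  have "deg \<omega> \<gamma> = 0" if "\<omega> \<in> PiD" "\<gamma> \<in> PiD" "u \<omega> \<in> P" "u \<gamma> \<in> P" for \<omega> \<gamma>
  proof (rule ccontr)
    assume "deg \<omega> \<gamma> \<noteq> 0"
    with that obtain c where "c \<in> carrier coordinate_ring"
      "u \<gamma> \<oplus>\<^bsub>coordinate_ring\<^esub> u \<omega> \<otimes>\<^bsub>coordinate_ring\<^esub> c = \<one>\<^bsub>coordinate_ring\<^esub>"
      using u_relation by blast
    with that have "\<one>\<^bsub>coordinate_ring\<^esub> \<in> P"
      by (metis P.I_r_closed additive_subgroup.a_closed[OF P.additive_subgroup_axioms])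
    then show False
      using P.one_imp_carrier P.I_notcarr by auto
  qed
  then show ?thesis
    by (auto simp: faces_def compatible_def pairwise_def)
qed

lemma closedin_closed_stratum: "F \<subseteq> PiD \<Longrightarrow> closedin M_tilde (closed_stratum F)"
  using u_in_carrier unfolding closed_stratum_def M_tilde_def
  by (subst ring.zero_locus_genideal[OF cring.axioms(1)[OF cring_coordinate_ring]])
    (auto intro!: closedin_zero_locus)

lemma stratum_locally_closed:
  assumes "F \<subseteq> PiD"
  shows "\<exists>C U. closedin M_tilde C \<and> openin M_tilde U \<and> stratum F = C \<inter> U"
proof -
  \<comment> \<open>For \<open>F = PiD\<close> the intersection runs over the empty family and is
    the whole type; \<open>topspace M_tilde\<close> cuts it down to an open set.\<close>
  let ?U = "topspace M_tilde \<inter> (\<Inter>\<gamma>\<in>PiD - F. nonvanishing_locus coordinate_ring (u \<gamma>))"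
  have "openin M_tilde ?U"
    using finite_PiD u_in_carrier
    by (intro openin_Int_Inter) (auto simp: M_tilde_def intro: openin_nonvanishing_locus)
  moreover have "stratum F = closed_stratum F \<inter> ?U"
    using closedin_subset[OF closedin_closed_stratum[OF assms]] by (auto simp: stratum_def)
  ultimately show ?thesis
    using closedin_closed_stratum[OF assms] by blast
qed

end

theorem proposition3p5:
  fixes I J :: "('v::linorder) set"
    and a :: "'v \<Rightarrow> 'v \<Rightarrow> int"
    and arr :: "'v \<Rightarrow> 'v \<Rightarrow> bool"
    and B :: "'v \<Rightarrow> 'v \<Rightarrow> int"
    and S :: "nat \<Rightarrow> 'v seed"
  assumes "dynkin_cluster I J a arr B S"
  shows "stratification (dynkin_cluster.M_tilde I J S)
           (dynkin_cluster.faces I J S) (dynkin_cluster.stratum I J S)"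
proof -
  interpret dynkin_cluster I J a arr B S
    by (rule assms)
  have sub: "F \<subseteq> PiD" if "F \<in> faces" for F
    using that by (simp add: faces_def)
  \<comment> \<open>Used twice: for \<open>F = {}\<close> it shows that the strata cover the space,
    and for general \<open>F\<close> it bounds the closure of a stratum.\<close>
  have closed_stratum_Union: "closed_stratum F \<subseteq> (\<Union>G\<in>{G \<in> faces. F \<subseteq> G}. stratum G)"
    if "F \<in> faces" for F
  proof
    fix P
    assume "P \<in> closed_stratum F"
    then have "P \<in> Spec coordinate_ring" "F \<subseteq> {\<gamma> \<in> PiD. u \<gamma> \<in> P}"
      using sub[OF that] by (auto simp: closed_stratum_eq)
    then show "P \<in> (\<Union>G\<in>{G \<in> faces. F \<subseteq> G}. stratum G)"
      by (intro UN_I[of "{\<gamma> \<in> PiD. u \<gamma> \<in> P}"]) (auto simp: vanishing_set_in_faces stratum_eq)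
  qed
  have "topspace M_tilde = (\<Union>F\<in>faces. stratum F)"
  proof
    show "topspace M_tilde \<subseteq> (\<Union>F\<in>faces. stratum F)"
      using closed_stratum_Union[of "{}"]
      by (auto simp: M_tilde_def topspace_zariski closed_stratum_eq faces_def)
    show "(\<Union>F\<in>faces. stratum F) \<subseteq> topspace M_tilde"
      using sub by (auto simp: stratum_eq M_tilde_def topspace_zariski)
  qed
  moreover have "disjoint_family_on stratum faces"
    using sub by (auto simp: disjoint_family_on_def stratum_eq)
  moreover have "M_tilde closure_of stratum F \<subseteq> (\<Union>G\<in>{G \<in> faces. F \<subseteq> G}. stratum G)"
    if "F \<in> faces" for F
  proof -
    \<comment> \<open>The closed stratum is a closed set containing the stratum, hence contains its
      closure.\<close>
    have "M_tilde closure_of stratum F \<subseteq> closed_stratum F"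
      using closedin_closed_stratum sub[OF that]
      by (intro closure_of_minimal) (auto simp: stratum_def)
    with closed_stratum_Union[OF that] show ?thesis by blast
  qed
  ultimately show ?thesis
    using stratum_locally_closed sub by (simp add: stratification_def)
qed

end
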